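(* Let $T\subset\mathbb R^n$ be a closed brick. (a) If $f:T\to\mathbb R$ is an unbounded K-integrable function, then there exists a bounded K-integrable function $g:T\to\mathbb R$ which is equal to $f$ Jordan almost everywhere, so that $\int_T f=\int_T g$ (K-integrals). (b) Every bounded K-integrable function $f:T\to\mathbb R$ is Riemann integrable, and its K-integral is equal to its Riemann integral. (c) There exist Riemann-integrable functions (real-valued, on a closed brick) that are not K-integrable.
   Context: Fix a positive integer $n$. A brick is a product $I_1\times\cdots\times I_n$ of $n$ bounded (nonempty) intervals (open, closed or half-open, possibly degenerate); its volume $\lambda$ is the product of the lengths of the intervals. A step function on $T$ is a finite linear combination $g=\sum_{j=1}^M c_j\chi_{T_j}$ of characteristic functions of bricks $T_j\subset T$; its integral is $\int_T g=\sum_j c_j\lambda(T_j)$. A sequence of functions $f_m:T\to\mathbb R$ converges nearly uniformly to $f:T\to\mathbb R$ if (i) the sequence $(f_m)$ is uniformly bounded on $T$, and (ii) for every $\delta>0$ there exist finitely many bricks contained in $T$, of total volume less than $\delta$, such that $f_m$ converges uniformly to $f$ on the complement (in $T$) of their union. A function $f:T\to\mathbb R$ is K-integrable if there is a sequence $(g_m)$ of step functions converging nearly uniformly to $f$; its K-integral is then $\int_T f:=\lim_{m\to\infty}\int_T g_m$ (the limit exists and does not depend on the choice of $(g_m)$). A set is a Jordan null set if for each $\varepsilon>0$ it can be covered by finitely many bricks of total volume less than $\varepsilon$; a property holds Jordan almost everywhere if it holds outside a Jordan null set. *)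

theory Defs
  imports "HOL-Analysis.Analysis"
begin

text \<open>
  A function \<open>T \<rightarrow> \<real>\<close> is represented by a total function on \<open>real ^ 'n\<close>; all
  notions below depend only on its values on \<open>T\<close>.
\<close>

definition box_prod :: "('n::finite \<Rightarrow> real set) \<Rightarrow> (real ^ 'n) set" where
  "box_prod I = {x. \<forall>i. x $ i \<in> I i}"

definition is_brick :: "(real ^ 'n::finite) set \<Rightarrow> bool" where
  "is_brick B \<longleftrightarrow>
     (\<exists>I. (\<forall>i. is_interval (I i) \<and> bounded (I i) \<and> I i \<noteq> {}) \<and> B = box_prod I)"

definition interval_length :: "real set \<Rightarrow> real" where
  "interval_length J = Sup J - Inf J"

text \<open>
  The factors of a (nonempty) brick are recovered as its coordinate projections, see
  \<open>brick_volume_box_prod\<close>.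
\<close>

definition brick_volume :: "(real ^ 'n::finite) set \<Rightarrow> real" where
  "brick_volume B = (\<Prod>i\<in>UNIV. interval_length ((\<lambda>x. x $ i) ` B))"

lemma brick_volume_box_prod:
  fixes I :: "'n::finite \<Rightarrow> real set"
  assumes "\<And>i. I i \<noteq> {}"
  shows "brick_volume (box_prod I) = (\<Prod>i\<in>UNIV. interval_length (I i))"
proof -
  obtain z where z: "\<And>i. z i \<in> I i"
    using that[of "\<lambda>i. SOME t. t \<in> I i"] assms by (simp add: some_in_eq)
  have "(\<lambda>x. x $ i) ` box_prod I = I i" for i
  proof (intro equalityI subsetI)
    fix t assume t: "t \<in> I i"
    have "(\<chi> j. if j = i then t else z j) \<in> box_prod I"
      using t z by (simp add: box_prod_def)
    then show "t \<in> (\<lambda>x. x $ i) ` box_prod I"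
      by (rule rev_image_eqI) simp
  qed (auto simp: box_prod_def)
  then show ?thesis
    by (simp add: brick_volume_def)
qed


definition has_step_integral ::
    "(real ^ 'n::finite \<Rightarrow> real) \<Rightarrow> real \<Rightarrow> (real ^ 'n) set \<Rightarrow> bool" where
  "has_step_integral g s T \<longleftrightarrow>
     (\<exists>(M::nat) c B.
        (\<forall>j<M. is_brick (B j) \<and> B j \<subseteq> T) \<and>
        (\<forall>x\<in>T. g x = (\<Sum>j<M. c j * indicator (B j) x)) \<and>
        s = (\<Sum>j<M. c j * brick_volume (B j)))"

definition step_function_on ::
    "(real ^ 'n::finite) set \<Rightarrow> (real ^ 'n \<Rightarrow> real) \<Rightarrow> bool" where
  "step_function_on T g \<longleftrightarrow>
     (\<exists>(M::nat) c B.
        (\<forall>j<M. is_brick (B j) \<and> B j \<subseteq> T) \<and>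
        (\<forall>x\<in>T. g x = (\<Sum>j<M. c j * indicator (B j) x)))"

definition step_integral :: "(real ^ 'n::finite) set \<Rightarrow> (real ^ 'n \<Rightarrow> real) \<Rightarrow> real" where
  "step_integral T g = (THE s. has_step_integral g s T)"

definition nearly_uniform_limit ::
    "(real ^ 'n::finite) set \<Rightarrow> (nat \<Rightarrow> real ^ 'n \<Rightarrow> real) \<Rightarrow> (real ^ 'n \<Rightarrow> real) \<Rightarrow> bool" where
  "nearly_uniform_limit T F f \<longleftrightarrow>
     (\<exists>C. \<forall>m. \<forall>x\<in>T. \<bar>F m x\<bar> \<le> C) \<and>
     (\<forall>\<delta>>0. \<exists>\<B>. finite \<B> \<and> (\<forall>B\<in>\<B>. is_brick B \<and> B \<subseteq> T) \<and>
        (\<Sum>B\<in>\<B>. brick_volume B) < \<delta> \<and>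
        uniform_limit (T - \<Union>\<B>) F f sequentially)"

definition K_integrable_on ::
    "(real ^ 'n::finite \<Rightarrow> real) \<Rightarrow> (real ^ 'n) set \<Rightarrow> bool" (infixr "K'_integrable'_on" 46) where
  "f K_integrable_on T \<longleftrightarrow>
     (\<exists>g. (\<forall>m. step_function_on T (g m)) \<and> nearly_uniform_limit T g f)"

definition has_K_integral ::
    "(real ^ 'n::finite \<Rightarrow> real) \<Rightarrow> real \<Rightarrow> (real ^ 'n) set \<Rightarrow> bool" where
  "has_K_integral f s T \<longleftrightarrow>
     (\<exists>g. (\<forall>m. step_function_on T (g m)) \<and> nearly_uniform_limit T g f \<and>
          (\<lambda>m. step_integral T (g m)) \<longlonglongrightarrow> s)"

definition K_integral :: "(real ^ 'n::finite) set \<Rightarrow> (real ^ 'n \<Rightarrow> real) \<Rightarrow> real" where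
  "K_integral T f = (THE s. has_K_integral f s T)"


definition Jordan_null :: "(real ^ 'n::finite) set \<Rightarrow> bool" where
  "Jordan_null N \<longleftrightarrow>
     (\<forall>\<epsilon>>0. \<exists>\<B>. finite \<B> \<and> (\<forall>B\<in>\<B>. is_brick B) \<and>
        (\<Sum>B\<in>\<B>. brick_volume B) < \<epsilon> \<and> N \<subseteq> \<Union>\<B>)"

definition Jordan_ae_on :: "(real ^ 'n::finite) set \<Rightarrow> (real ^ 'n \<Rightarrow> bool) \<Rightarrow> bool" where
  "Jordan_ae_on T P \<longleftrightarrow> (\<exists>N. Jordan_null N \<and> (\<forall>x\<in>T - N. P x))"


text \<open>
  The Riemann integral of a bounded function, as the limit of Riemann sums over tagged divisions
  whose mesh tends to 0.  It differs from \<open>has_integral\<close> of the library (the gauge integral) in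
  that the gauge is a ball of constant radius.
\<close>

definition has_Riemann_integral ::
    "(real ^ 'n::finite \<Rightarrow> real) \<Rightarrow> real \<Rightarrow> (real ^ 'n) set \<Rightarrow> bool" where
  "has_Riemann_integral f s T \<longleftrightarrow>
     bounded (f ` T) \<and>
     (\<forall>\<epsilon>>0. \<exists>\<delta>>0. \<forall>p. p tagged_division_of T \<and> (\<lambda>x. ball x \<delta>) fine p \<longrightarrow>
        \<bar>(\<Sum>(x, k)\<in>p. measure lborel k * f x) - s\<bar> < \<epsilon>)"

definition Riemann_integrable_on ::
    "(real ^ 'n::finite \<Rightarrow> real) \<Rightarrow> (real ^ 'n) set \<Rightarrow> bool"
    (infixr "Riemann'_integrable'_on" 46) where
  "f Riemann_integrable_on T \<longleftrightarrow> (\<exists>s. has_Riemann_integral f s T)"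

definition Riemann_integral :: "(real ^ 'n::finite) set \<Rightarrow> (real ^ 'n \<Rightarrow> real) \<Rightarrow> real" where
  "Riemann_integral T f = (THE s. has_Riemann_integral f s T)"

end

theory Submission
  imports Defs
begin

text \<open>
  By dominated convergence the K-integral is the gauge integral. A bounded K-integrable function is
  Riemann integrable because, up to \<open>\<epsilon>\<close> plus a multiple of the indicators of finitely many bricks of
  small total volume, it is a step function, and Riemann sums of the indicator of a brick converge
  to its volume. Truncating at the uniform bound of the approximating step functions
  changes an unbounded K-integrable function only where these fail to converge, a Jordan null set.

  On the complement of finitely many bricks of small total volume a K-integrable function is a
  uniform limit of step functions, hence has limits along rays as long as they start in the
  interior of that complement. A Riemann integrable function without right-hand limits at any
  rational value of one coordinate is therefore not K-integrable.
\<close>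

section \<open>Bricks and step functions\<close>

lemma is_brick_imp_is_interval:
  assumes "is_brick B"
  shows "is_interval B"
proof -
  obtain I where "\<forall>i. is_interval (I i) \<and> bounded (I i) \<and> I i \<noteq> {}" and B: "B = box_prod I"
    using assms unfolding is_brick_def by (elim exE conjE)
  then have I: "\<And>i. is_interval (I i)"
    by simp
  have "x \<in> B" if "p \<in> B" "q \<in> B"
    and x: "\<And>i. p $ i \<le> x $ i \<and> x $ i \<le> q $ i \<or> q $ i \<le> x $ i \<and> x $ i \<le> p $ i" for p q x
  proof -
    have "x $ i \<in> I i" for i
      using that(1,2) x[of i] mem_is_interval_1_I[OF I] unfolding B box_prod_def by blast
    then show ?thesis
      by (simp add: B box_prod_def)
  qed
  then show ?thesis
    unfolding is_interval_cart by blast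
qed

lemma is_brick_imp_bounded:
  assumes "is_brick B"
  shows "bounded B"
proof -
  obtain I where "\<forall>i. is_interval (I i) \<and> bounded (I i) \<and> I i \<noteq> {}" and B: "B = box_prod I"
    using assms unfolding is_brick_def by (elim exE conjE)
  then have "\<forall>i. \<exists>c. \<forall>y\<in>I i. \<bar>y\<bar> \<le> c"
    by (simp add: bounded_iff)
  then obtain c where c: "\<And>i y. y \<in> I i \<Longrightarrow> \<bar>y\<bar> \<le> c i"
    by metis
  have "norm x \<le> sum c UNIV" if "x \<in> B" for x
  proof -
    have "norm x \<le> (\<Sum>i\<in>UNIV. \<bar>x $ i\<bar>)"
      by (rule norm_le_l1_cart)
    also have "\<dots> \<le> sum c UNIV"
      using that c by (intro sum_mono) (simp add: B box_prod_def)
    finally show ?thesis .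
  qed
  then show ?thesis
    unfolding bounded_iff by blast
qed

lemma is_brick_imp_convex: "is_brick B \<Longrightarrow> convex B"
  by (simp add: is_brick_imp_is_interval is_interval_convex)

lemma is_brick_imp_lmeasurable: "is_brick B \<Longrightarrow> B \<in> lmeasurable"
  by (simp add: is_brick_imp_convex is_brick_imp_bounded measurable_convex)

text \<open>A closed bounded interval is compact, and compact intervals are exactly the sets
  \<open>cbox a b\<close>. This makes gauge integrals and tagged divisions available on
  \<open>T\<close>.\<close>

lemma closed_brick_eq_cbox:
  assumes "is_brick T" "closed T"
  obtains a b where "T = cbox a b"
  using assms is_interval_compact is_brick_imp_is_interval is_brick_imp_bounded
    compact_eq_bounded_closed by metis

text \<open>A brick lies between the open and the closed box spanned by the infima and suprema of
  its factors. These two boxes differ by a null set, so it does not matter which endpoints belong to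
  the factors.\<close>

lemma measure_brick:
  fixes B :: "(real ^ 'n::finite) set"
  assumes "is_brick B"
  shows "measure lebesgue B = brick_volume B"
proof -
  obtain I where "\<forall>i. is_interval (I i) \<and> bounded (I i) \<and> I i \<noteq> {}" and B: "B = box_prod I"
    using assms unfolding is_brick_def by (elim exE conjE)
  then have I: "\<And>i. is_interval (I i)" "\<And>i. bounded (I i)" "\<And>i. I i \<noteq> {}"
    by simp_all
  define a b :: "real ^ 'n" where "a = (\<chi> i. Inf (I i))" and "b = (\<chi> i. Sup (I i))"
  have bdd: "bdd_above (I i)" "bdd_below (I i)" for i
    using I(2) by (simp_all add: bounded_imp_bdd_above bounded_imp_bdd_below)
  have sub: "B \<subseteq> cbox a b"
    using bdd by (auto simp: B box_prod_def mem_box_cart a_def b_def cInf_lower cSup_upper)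
  have sup: "box a b \<subseteq> B"
  proof
    fix x assume x: "x \<in> box a b"
    have "x $ i \<in> I i" for i
    proof -
      have "Inf (I i) < x $ i" "x $ i < Sup (I i)"
        using x by (simp_all add: mem_box_cart a_def b_def)
      then obtain u v where "u \<in> I i" "u < x $ i" "v \<in> I i" "x $ i < v"
        using I(3) bdd by (meson cInf_less_iff less_cSup_iff)
      then show ?thesis
        using I(1)[of i] unfolding is_interval_1 by (meson less_imp_le)
    qed
    then show "x \<in> B"
      by (simp add: B box_prod_def)
  qed
  have "measure lebesgue B = measure lebesgue (cbox a b)"
  proof (rule measure_negligible_symdiff)
    show "negligible (cbox a b - B \<union> (B - cbox a b))"
      by (rule negligible_subset[OF negligible_frontier_interval[of a b]]) (use sub sup in auto)
  qed simp
  also have "\<dots> = (\<Prod>i\<in>UNIV. b $ i - a $ i)"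
  proof -
    \<comment> \<open>The product formula for the content is applied to a nonempty box; a point of
      \<open>B\<close>, chosen factor by factor, shows that \<open>cbox a b\<close> is
      nonempty.\<close>
    have "\<forall>i. \<exists>y. y \<in> I i"
      using I(3) by (simp add: ex_in_conv)
    then obtain z where "\<forall>i. z i \<in> I i"
      by metis
    then have "(\<chi> i. z i) \<in> B"
      by (simp add: B box_prod_def)
    then have "cbox a b \<noteq> {}"
      using sub by blast
    then show ?thesis
      by (simp add: content_cbox_cart)
  qed
  also have "\<dots> = brick_volume B"
    using I(3) by (simp add: B brick_volume_box_prod interval_length_def a_def b_def)
  finally show ?thesis .
qed

text \<open>The gauge integral sees only the values of \<open>g\<close>, not its representation, so
  this will show that all representations yield the same sum \<open>s\<close>.\<close>

lemma has_step_integral_imp_has_integral: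
  assumes "has_step_integral g s T"
  shows "(g has_integral s) T"
proof -
  obtain M :: nat and c B where B: "\<forall>j<M. is_brick (B j) \<and> B j \<subseteq> T"
    and g: "\<forall>x\<in>T. g x = (\<Sum>j<M. c j * indicator (B j) x)"
    and s: "s = (\<Sum>j<M. c j * brick_volume (B j))"
    using assms unfolding has_step_integral_def by (elim exE conjE)
  have "(indicat_real (B j) has_integral brick_volume (B j)) T" if "j < M" for j
  proof -
    have j: "is_brick (B j)" "B j \<subseteq> T"
      using B that by simp_all
    then have "(indicat_real (B j) has_integral brick_volume (B j)) UNIV"
      using is_brick_imp_lmeasurable lmeasurable_iff_has_integral measure_brick by metis
    moreover have "indicat_real (B j) = (\<lambda>x. if x \<in> T then indicator (B j) x else 0)"
      using j(2) by (auto simp: fun_eq_iff indicator_def)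
    ultimately have "((\<lambda>x. if x \<in> T then indicat_real (B j) x else 0) has_integral brick_volume (B j)) UNIV"
      by argo
    then show ?thesis
      by (simp only: has_integral_restrict_UNIV)
  qed
  then have "((\<lambda>x. \<Sum>j<M. c j * indicator (B j) x) has_integral s) T"
    unfolding s by (intro has_integral_sum has_integral_mult_right) auto
  then show ?thesis
    by (rule has_integral_eq[rotated]) (use g in simp)
qed

text \<open>Every candidate for the step integral equals the gauge integral, so the definite
  description in \<open>step_integral\<close> denotes.\<close>

lemma
  assumes "step_function_on T g"
  shows step_function_integrable: "g integrable_on T"
    and step_integral_eq_integral: "step_integral T g = integral T g"
    and has_step_integral_integral: "has_step_integral g (integral T g) T"
proof -
  obtain s where s: "has_step_integral g s T"
    using assms unfolding has_step_integral_def step_function_on_def by (elim exE) blast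
  have "s' = integral T g" if "has_step_integral g s' T" for s'
    using integral_unique[OF has_step_integral_imp_has_integral[OF that]] by simp
  then show "step_integral T g = integral T g" "has_step_integral g (integral T g) T"
    using s unfolding step_integral_def by (auto intro!: the_equality)
  show "g integrable_on T"
    using has_step_integral_imp_has_integral[OF s] by blast
qed

section \<open>The K-integral as a gauge integral\<close>

text \<open>The covering bricks form a measurable set whose measure is at most their total volume.
  Exceptional sets can thus be ignored in gauge integrals.\<close>

lemma Jordan_null_imp_negligible:
  assumes "Jordan_null N"
  shows "negligible N"
  unfolding negligible_outer_le
proof (intro allI impI)
  fix e :: real assume "e > 0"
  then obtain \<B> where \<B>: "finite \<B>" "\<forall>B\<in>\<B>. is_brick B"
    "(\<Sum>B\<in>\<B>. brick_volume B) < e" "N \<subseteq> \<Union>\<B>"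
    using assms unfolding Jordan_null_def by metis
  have "measure lebesgue (\<Union>\<B>) \<le> (\<Sum>B\<in>\<B>. measure lebesgue B)"
    using \<B> by (intro measure_Union_le) (auto simp: is_brick_imp_lmeasurable fmeasurableD)
  also have "\<dots> = (\<Sum>B\<in>\<B>. brick_volume B)"
    using \<B> by (intro sum.cong) (auto simp: measure_brick)
  finally have "measure lebesgue (\<Union>\<B>) \<le> e"
    using \<B>(3) by simp
  moreover have "\<Union>\<B> \<in> lmeasurable"
    using \<B> by (intro fmeasurable.finite_Union) (auto simp: is_brick_imp_lmeasurable)
  ultimately show "\<exists>S. N \<subseteq> S \<and> S \<in> lmeasurable \<and> measure lebesgue S \<le> e"
    using \<B>(4) by blast
qed

lemma nearly_uniform_limit_cover:
  assumes "nearly_uniform_limit T F f" "\<delta> > 0"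
  obtains \<B> where "finite \<B>" "\<forall>B\<in>\<B>. is_brick B \<and> B \<subseteq> T"
    "(\<Sum>B\<in>\<B>. brick_volume B) < \<delta>" "uniform_limit (T - \<Union>\<B>) F f sequentially"
  using assms unfolding nearly_uniform_limit_def by metis

text \<open>The exceptional bricks may change with \<delta>, but each choice covers the one fixed
  set of points where pointwise convergence fails.\<close>

lemma nearly_uniform_limit_Jordan_null:
  assumes "nearly_uniform_limit T F f"
  shows "Jordan_null {x\<in>T. \<not> (\<lambda>m. F m x) \<longlonglongrightarrow> f x}"
  unfolding Jordan_null_def
proof (intro allI impI)
  fix \<epsilon> :: real assume "\<epsilon> > 0"
  then obtain \<B> where \<B>: "finite \<B>" "\<forall>B\<in>\<B>. is_brick B \<and> B \<subseteq> T"
    "(\<Sum>B\<in>\<B>. brick_volume B) < \<epsilon>" "uniform_limit (T - \<Union>\<B>) F f sequentially"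
    using nearly_uniform_limit_cover[OF assms] by metis
  have "{x\<in>T. \<not> (\<lambda>m. F m x) \<longlonglongrightarrow> f x} \<subseteq> \<Union>\<B>"
    using tendsto_uniform_limitI[OF \<B>(4)] by blast
  then show "\<exists>\<B>. finite \<B> \<and> (\<forall>B\<in>\<B>. is_brick B) \<and> (\<Sum>B\<in>\<B>. brick_volume B) < \<epsilon> \<and>
      {x\<in>T. \<not> (\<lambda>m. F m x) \<longlonglongrightarrow> f x} \<subseteq> \<Union>\<B>"
    using \<B> by blast
qed

lemma nearly_uniform_limit_integral:
  assumes "nearly_uniform_limit (cbox a b) F f" and F: "\<And>m. F m integrable_on cbox a b"
  shows "(\<lambda>m. integral (cbox a b) (F m)) \<longlonglongrightarrow> integral (cbox a b) f"
proof -
  define N where "N = {x\<in>cbox a b. \<not> (\<lambda>m. F m x) \<longlonglongrightarrow> f x}"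
  have N: "negligible N"
    unfolding N_def using assms(1) by (intro Jordan_null_imp_negligible nearly_uniform_limit_Jordan_null)
  obtain C where C: "\<And>m x. x \<in> cbox a b \<Longrightarrow> \<bar>F m x\<bar> \<le> C"
    using assms(1) unfolding nearly_uniform_limit_def by blast
  \<comment> \<open>Dominated convergence is applied with convergence at every point of the box, so
    all functions are set to 0 on the null set \<open>N\<close>; no integral changes.\<close>
  define F' f' where "F' m x = (if x \<in> N then 0 else F m x)" and "f' x = (if x \<in> N then 0 else f x)" for m x
  have F': "F' m integrable_on cbox a b" for m
    using F N by (rule integrable_spike) (auto simp: F'_def)
  have le: "norm (F' m x) \<le> \<bar>C\<bar>" if "x \<in> cbox a b" for m x
    using C[OF that, of m] by (auto simp: F'_def)
  have conv: "(\<lambda>m. F' m x) \<longlonglongrightarrow> f' x" if "x \<in> cbox a b" for x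
    using that by (auto simp: F'_def f'_def N_def)
  have int: "integral (cbox a b) (F' m) = integral (cbox a b) (F m)" for m
    using N by (rule integral_spike) (auto simp: F'_def)
  have "(\<lambda>m. integral (cbox a b) (F' m)) \<longlonglongrightarrow> integral (cbox a b) f'"
    using dominated_convergence(2)[OF F' _ le conv] by (simp add: integrable_on_const)
  moreover have "integral (cbox a b) f' = integral (cbox a b) f"
    using N by (rule integral_spike) (auto simp: f'_def)
  ultimately show "(\<lambda>m. integral (cbox a b) (F m)) \<longlonglongrightarrow> integral (cbox a b) f"
    by (simp add: int)
qed

text \<open>Along any approximating sequence the step integrals converge to the gauge integral of
  \<open>f\<close>. Hence the limit exists and does not depend on the sequence.\<close>

lemma has_K_integral_iff:
  "has_K_integral f s (cbox a b) \<longleftrightarrow> f K_integrable_on cbox a b \<and> s = integral (cbox a b) f"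
proof -
  have "(\<lambda>m. step_integral (cbox a b) (g m)) \<longlonglongrightarrow> integral (cbox a b) f"
    if "\<forall>m. step_function_on (cbox a b) (g m)" "nearly_uniform_limit (cbox a b) g f" for g
    using that nearly_uniform_limit_integral[OF that(2)]
    by (simp add: step_integral_eq_integral step_function_integrable)
  then show ?thesis
    unfolding has_K_integral_def K_integrable_on_def by (meson LIMSEQ_unique)
qed

lemma K_integral_eq_integral:
  assumes "f K_integrable_on cbox a b"
  shows "K_integral (cbox a b) f = integral (cbox a b) f"
  unfolding K_integral_def using assms by (simp add: has_K_integral_iff)

section \<open>Bounded modification of a K-integrable function\<close>

lemma K_integrable_bounded_modification:
  assumes "f K_integrable_on cbox a b"
  obtains g where "g K_integrable_on cbox a b" "bounded (g ` cbox a b)"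
    "Jordan_ae_on (cbox a b) (\<lambda>x. g x = f x)"
    "K_integral (cbox a b) f = K_integral (cbox a b) g"
proof -
  obtain F where F: "\<And>m. step_function_on (cbox a b) (F m)" and lim: "nearly_uniform_limit (cbox a b) F f"
    using assms unfolding K_integrable_on_def by blast
  obtain C where C: "\<And>m x. x \<in> cbox a b \<Longrightarrow> \<bar>F m x\<bar> \<le> C"
    using lim unfolding nearly_uniform_limit_def by blast
  \<comment> \<open>The threshold is the common bound of the step functions: wherever
    \<open>F m x\<close> converges to \<open>f x\<close>, the limit inherits the bound
    \<open>C\<close>, and \<open>g\<close> keeps the value of \<open>f\<close>.\<close>
  define g where "g x = (if \<bar>f x\<bar> \<le> C then f x else 0)" for x
  have eq: "g x = f x" if "x \<in> cbox a b" "(\<lambda>m. F m x) \<longlonglongrightarrow> f x" for x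
  proof -
    have "\<bar>f x\<bar> \<le> C"
      using that C by (intro LIMSEQ_le_const2[OF tendsto_rabs[OF that(2)]]) auto
    then show ?thesis
      by (simp add: g_def)
  qed
  \<comment> \<open>Off the exceptional bricks convergence forces \<open>g\<close> and
    \<open>f\<close> to agree, so the same sequence with the same bricks approximates
    \<open>g\<close>.\<close>
  have "uniform_limit (cbox a b - \<Union>\<B>) F g sequentially"
    if "uniform_limit (cbox a b - \<Union>\<B>) F f sequentially" for \<B>
  proof -
    have "g x = f x" if "x \<in> cbox a b - \<Union>\<B>" for x
      using that eq tendsto_uniform_limitI[OF \<open>uniform_limit _ F f _\<close>, of x] by blast
    then show ?thesis
      using that by (subst uniform_limit_cong'[where g = F and i = f]) auto
  qed
  then have glim: "nearly_uniform_limit (cbox a b) F g"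
    using lim unfolding nearly_uniform_limit_def by meson
  then have gK: "g K_integrable_on cbox a b"
    using F unfolding K_integrable_on_def by blast
  have "bounded (g ` cbox a b)"
    unfolding bounded_iff by (intro exI[of _ "\<bar>C\<bar>"]) (auto simp: g_def)
  moreover have "Jordan_ae_on (cbox a b) (\<lambda>x. g x = f x)"
    unfolding Jordan_ae_on_def using nearly_uniform_limit_Jordan_null[OF lim] eq by blast
  \<comment> \<open>Both integrals are limits of the one sequence of integrals of
    \<open>F m\<close>.\<close>
  moreover have "integral (cbox a b) f = integral (cbox a b) g"
    using nearly_uniform_limit_integral[OF lim] nearly_uniform_limit_integral[OF glim]
      F step_function_integrable LIMSEQ_unique by blast
  ultimately show ?thesis
    using that gK assms by (simp add: K_integral_eq_integral)
qed

section \<open>Riemann sums\<close>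

abbreviation Riemann_sum ::
  "(real ^ 'n::finite \<Rightarrow> real) \<Rightarrow> ((real ^ 'n) \<times> (real ^ 'n) set) set \<Rightarrow> real" where
  "Riemann_sum f p \<equiv> (\<Sum>(x, k)\<in>p. measure lborel k * f x)"

lemma Riemann_sum_add: "Riemann_sum (\<lambda>x. f x + g x) p = Riemann_sum f p + Riemann_sum g p"
  by (simp add: sum.distrib split_def algebra_simps)

lemma Riemann_sum_diff: "Riemann_sum (\<lambda>x. f x - g x) p = Riemann_sum f p - Riemann_sum g p"
  by (simp add: sum_subtractf split_def algebra_simps)

lemma Riemann_sum_cmult: "Riemann_sum (\<lambda>x. c * f x) p = c * Riemann_sum f p"
  by (simp add: sum_distrib_left split_def algebra_simps)

lemma Riemann_sum_const:
  assumes "p tagged_division_of cbox a b"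
  shows "Riemann_sum (\<lambda>x. c) p = measure lborel (cbox a b) * c"
  using additive_content_tagged_division[OF assms]
  by (simp add: sum_distrib_right[symmetric] split_def)

lemma Riemann_sum_mono:
  assumes "p tagged_division_of T" "\<And>x. x \<in> T \<Longrightarrow> f x \<le> g x"
  shows "Riemann_sum f p \<le> Riemann_sum g p"
proof (rule sum_mono)
  fix z assume "z \<in> p"
  then show "(case z of (x, k) \<Rightarrow> measure lborel k * f x) \<le> (case z of (x, k) \<Rightarrow> measure lborel k * g x)"
    using assms tag_in_interval[OF assms(1)] by (cases z) (auto intro: mult_left_mono)
qed

lemma Riemann_sum_cong:
  assumes "p tagged_division_of T" "\<And>x. x \<in> T \<Longrightarrow> f x = g x"
  shows "Riemann_sum f p = Riemann_sum g p"
  using assms by (intro antisym Riemann_sum_mono) auto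

lemma fine_ball_mono: "(\<lambda>x. ball x \<delta>) fine p \<Longrightarrow> \<delta> \<le> \<delta>' \<Longrightarrow> (\<lambda>x. ball x \<delta>') fine p"
  unfolding fine_def using subset_ball by fastforce

section \<open>Linearity of the Riemann integral and its comparison with the gauge integral\<close>

lemma has_Riemann_integral_cong:
  assumes "\<And>x. x \<in> T \<Longrightarrow> f x = g x"
  shows "has_Riemann_integral f s T \<longleftrightarrow> has_Riemann_integral g s T"
proof -
  have "f ` T = g ` T"
    using assms by (rule image_cong[OF refl])
  then show ?thesis
    unfolding has_Riemann_integral_def using Riemann_sum_cong[of _ T f g] assms by metis
qed

lemma has_Riemann_integral_const: "has_Riemann_integral (\<lambda>x. c) (measure lborel (cbox a b) * c) (cbox a b)"
  unfolding has_Riemann_integral_def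
  by (auto simp: Riemann_sum_const image_constant_conv intro: exI[of _ 1])

lemma has_Riemann_integral_add:
  assumes f: "has_Riemann_integral f s T" and g: "has_Riemann_integral g t T"
  shows "has_Riemann_integral (\<lambda>x. f x + g x) (s + t) T"
  unfolding has_Riemann_integral_def
proof (intro conjI allI impI)
  show "bounded ((\<lambda>x. f x + g x) ` T)"
    using f g unfolding has_Riemann_integral_def by (intro bounded_plus_comp) auto
next
  fix \<epsilon> :: real assume "\<epsilon> > 0"
  then have "\<epsilon> / 2 > 0"
    by simp
  then obtain d e where "d > 0" "e > 0"
    and d: "\<And>p. p tagged_division_of T \<Longrightarrow> (\<lambda>x. ball x d) fine p \<Longrightarrow> \<bar>Riemann_sum f p - s\<bar> < \<epsilon> / 2"
    and e: "\<And>p. p tagged_division_of T \<Longrightarrow> (\<lambda>x. ball x e) fine p \<Longrightarrow> \<bar>Riemann_sum g p - t\<bar> < \<epsilon> / 2"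
    using f g unfolding has_Riemann_integral_def by metis
  have "\<bar>Riemann_sum (\<lambda>x. f x + g x) p - (s + t)\<bar> < \<epsilon>"
    if p: "p tagged_division_of T" "(\<lambda>x. ball x (min d e)) fine p" for p
  proof -
    have "\<bar>Riemann_sum f p - s\<bar> < \<epsilon> / 2" "\<bar>Riemann_sum g p - t\<bar> < \<epsilon> / 2"
      using d[OF p(1) fine_ball_mono[OF p(2) min.cobounded1]]
        e[OF p(1) fine_ball_mono[OF p(2) min.cobounded2]] by simp_all
    then show ?thesis
      unfolding Riemann_sum_add by linarith
  qed
  then show "\<exists>\<delta>>0. \<forall>p. p tagged_division_of T \<and> (\<lambda>x. ball x \<delta>) fine p \<longrightarrow>
      \<bar>Riemann_sum (\<lambda>x. f x + g x) p - (s + t)\<bar> < \<epsilon>"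
    using \<open>d > 0\<close> \<open>e > 0\<close> by (intro exI[of _ "min d e"]) auto
qed

lemma has_Riemann_integral_cmult:
  assumes f: "has_Riemann_integral f s T"
  shows "has_Riemann_integral (\<lambda>x. c * f x) (c * s) T"
  unfolding has_Riemann_integral_def
proof (intro conjI allI impI)
  show "bounded ((\<lambda>x. c * f x) ` T)"
    using f bounded_scaleR_comp[of f T c] unfolding has_Riemann_integral_def by simp
next
  fix \<epsilon> :: real assume "\<epsilon> > 0"
  \<comment> \<open>Adding 1 keeps the denominator positive when \<open>c\<close> is 0.\<close>
  then have "\<epsilon> / (\<bar>c\<bar> + 1) > 0"
    by simp
  then obtain d where "d > 0"
    and d: "\<And>p. p tagged_division_of T \<Longrightarrow> (\<lambda>x. ball x d) fine p \<Longrightarrow>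
      \<bar>Riemann_sum f p - s\<bar> < \<epsilon> / (\<bar>c\<bar> + 1)"
    using f unfolding has_Riemann_integral_def by metis
  have "\<bar>Riemann_sum (\<lambda>x. c * f x) p - c * s\<bar> < \<epsilon>"
    if p: "p tagged_division_of T" "(\<lambda>x. ball x d) fine p" for p
  proof -
    have "\<bar>Riemann_sum (\<lambda>x. c * f x) p - c * s\<bar> = \<bar>c\<bar> * \<bar>Riemann_sum f p - s\<bar>"
      unfolding Riemann_sum_cmult by (simp add: abs_mult flip: right_diff_distrib)
    also have "\<dots> \<le> (\<bar>c\<bar> + 1) * \<bar>Riemann_sum f p - s\<bar>"
      by (intro mult_right_mono) auto
    also have "\<dots> < \<epsilon>"
      using d[OF p] by (simp add: pos_less_divide_eq mult.commute)
    finally show ?thesis .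
  qed
  then show "\<exists>\<delta>>0. \<forall>p. p tagged_division_of T \<and> (\<lambda>x. ball x \<delta>) fine p \<longrightarrow>
      \<bar>Riemann_sum (\<lambda>x. c * f x) p - c * s\<bar> < \<epsilon>"
    using \<open>d > 0\<close> by blast
qed

lemma has_Riemann_integral_sum:
  assumes "finite A" "\<And>i. i \<in> A \<Longrightarrow> has_Riemann_integral (f i) (s i) (cbox a b)"
  shows "has_Riemann_integral (\<lambda>x. \<Sum>i\<in>A. f i x) (\<Sum>i\<in>A. s i) (cbox a b)"
  using assms
proof (induction A rule: finite_induct)
  case empty
  then show ?case
    using has_Riemann_integral_const[of 0] by simp
next
  case (insert i A)
  then show ?case
    by (simp add: has_Riemann_integral_add)
qed

text \<open>Balls of constant radius form a gauge. Uniqueness of the Riemann integral is inherited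
  from the gauge integral in this way.\<close>

lemma has_Riemann_integral_imp_has_integral:
  assumes "has_Riemann_integral f s (cbox a b)"
  shows "(f has_integral s) (cbox a b)"
  unfolding has_integral
proof (intro allI impI)
  fix e :: real assume "e > 0"
  then obtain d where "d > 0"
    and d: "\<And>p. p tagged_division_of cbox a b \<Longrightarrow> (\<lambda>x. ball x d) fine p \<Longrightarrow> \<bar>Riemann_sum f p - s\<bar> < e"
    using assms unfolding has_Riemann_integral_def by metis
  show "\<exists>\<gamma>. gauge \<gamma> \<and> (\<forall>\<D>. \<D> tagged_division_of cbox a b \<and> \<gamma> fine \<D> \<longrightarrow>
      norm ((\<Sum>(x, k)\<in>\<D>. measure lborel k *\<^sub>R f x) - s) < e)"
    using d \<open>d > 0\<close> by (intro exI[of _ "\<lambda>x. ball x d"]) (auto simp: gauge_ball)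
qed

lemma Riemann_integral_eq:
  assumes "has_Riemann_integral f s (cbox a b)"
  shows "Riemann_integral (cbox a b) f = s"
  unfolding Riemann_integral_def
  using assms has_Riemann_integral_imp_has_integral has_integral_unique by (intro the_equality) blast+

text \<open>Cells of a fine division tagged in \<open>E\<close> stay within distance
  \<open>d\<close> of \<open>E\<close>, and the measure of such a neighbourhood exceeds that of
  \<open>E\<close> by less than \<open>e\<close>, because the frontier is null. The radius
  \<open>d\<close> depends only on \<open>E\<close> and \<open>e\<close>.\<close>

lemma Riemann_sum_indicator_less:
  fixes E :: "(real ^ 'n::finite) set"
  assumes "bounded E" "negligible (frontier E)" "e > 0"
  obtains d where "d > 0"
    "\<And>p a b. p tagged_division_of cbox a b \<Longrightarrow> (\<lambda>x. ball x d) fine p \<Longrightarrow>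
       Riemann_sum (indicator E) p < measure lebesgue E + e"
proof -
  obtain d where "d > 0" and d: "\<And>S. \<lbrakk>S \<in> lmeasurable; \<And>y. y \<in> S \<Longrightarrow> \<exists>x. x \<in> E \<and> dist x y < d\<rbrakk>
      \<Longrightarrow> measure lebesgue S < measure lebesgue E + e"
    using measure_semicontinuous_with_hausdist_explicit[OF assms] by metis
  have "Riemann_sum (indicator E) p < measure lebesgue E + e"
    if p: "p tagged_division_of cbox a b" "(\<lambda>x. ball x d) fine p" for p a b
  proof -
    define U where "U = (\<Union>x\<in>E. ball x d) \<inter> cbox a b"
    have "(\<Union>x\<in>E. ball x d) \<in> sets lborel"
      by (simp add: borel_open open_UN)
    then have "(\<Union>x\<in>E. ball x d) \<in> sets lebesgue"
      by (rule sets_completionI_sets)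
    then have U: "U \<in> lmeasurable"
      unfolding U_def Int_commute[of _ "cbox a b"] by (intro fmeasurable_Int_fmeasurable) auto
    have int: "indicat_real U integrable_on cbox a b"
      using U by (simp add: integrable_on_indicator U_def Int_assoc)
    \<comment> \<open>Compared cell by cell: a cell tagged in \<open>E\<close> lies inside
      \<open>U\<close> and contributes its full volume on both sides; any other cell contributes 0
      on the left. Additivity of the integral over the division then replaces a count of the
      cells.\<close>
    have "Riemann_sum (indicator E) p \<le> (\<Sum>(x, k)\<in>p. integral k (indicat_real U))"
    proof (rule sum_mono)
      fix z assume "z \<in> p"
      then obtain x k where z: "z = (x, k)" "(x, k) \<in> p"
        by (cases z) auto
      have k: "k \<subseteq> cbox a b" "\<exists>u v. k = cbox u v"
        using tagged_division_ofD(3,4)[OF p(1) z(2)] by auto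
      have "indicator E x * measure lborel k \<le> integral k (indicat_real U)"
      proof (cases "x \<in> E")
        case True
        have "k \<subseteq> U"
          using True p(2) z(2) k(1) unfolding fine_def U_def by blast
        then have "integral k (indicat_real U) = integral k (\<lambda>x. 1)"
          by (intro integral_cong) auto
        then show ?thesis
          using True k(2) by auto
      next
        case False
        have "indicat_real U integrable_on k"
          using k integrable_on_subcbox[OF int] by blast
        then have "0 \<le> integral k (indicat_real U)"
          by (rule integral_nonneg) auto
        then show ?thesis
          using False by simp
      qed
      then show "(case z of (x, k) \<Rightarrow> measure lborel k * indicator E x) \<le>
          (case z of (x, k) \<Rightarrow> integral k (indicat_real U))"
        by (simp add: z mult.commute)
    qed
    also have "\<dots> = integral (cbox a b) (indicat_real U)"
      by (rule integral_combine_tagged_division_topdown[OF int p(1), symmetric])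
    also have "\<dots> = measure lebesgue U"
      using U by (subst integral_indicator) (auto simp: U_def Int_assoc)
    also have "\<dots> < measure lebesgue E + e"
      using U by (rule d) (auto simp: U_def)
    finally show ?thesis .
  qed
  with \<open>d > 0\<close> that show ?thesis
    by blast
qed

text \<open>The lower estimate is the upper one applied to the complement of \<open>E\<close>.\<close>

lemma has_Riemann_integral_indicator:
  fixes E :: "(real ^ 'n::finite) set"
  assumes sub: "E \<subseteq> cbox a b" and neg: "negligible (frontier E)"
  shows "has_Riemann_integral (indicator E) (measure lebesgue E) (cbox a b)"
  unfolding has_Riemann_integral_def
proof (intro conjI allI impI)
  show "bounded (indicat_real E ` cbox a b)"
    by (rule bounded_subset[of "{0, 1}"]) (auto simp: indicator_def)
next
  fix \<epsilon> :: real assume "\<epsilon> > 0"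
  define E' where "E' = cbox a b - E"
  have bE: "bounded E" "bounded E'"
    using sub bounded_cbox bounded_subset unfolding E'_def by blast+
  have negE': "negligible (frontier E')"
  proof (rule negligible_subset)
    \<comment> \<open>\<open>E'\<close> is the intersection of the box with the complement of
      \<open>E\<close>, and complements share their frontier.\<close>
    show "frontier E' \<subseteq> frontier (cbox a b) \<union> frontier E"
      unfolding E'_def Diff_eq using frontier_Int_subset[of "cbox a b" "- E"] by simp
    show "negligible (frontier (cbox a b) \<union> frontier E)"
      using neg by (simp add: negligible_Un negligible_convex_frontier)
  qed
  have meas: "E \<in> lmeasurable"
    using bE(1) neg by (rule measurable_Jordan)
  have measE': "measure lebesgue E' = measure lborel (cbox a b) - measure lebesgue E"
    unfolding E'_def using sub meas by (subst measurable_measure_Diff) auto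
  obtain d where "d > 0"
    and d: "\<And>p. p tagged_division_of cbox a b \<Longrightarrow> (\<lambda>x. ball x d) fine p \<Longrightarrow>
       Riemann_sum (indicator E) p < measure lebesgue E + \<epsilon>"
    using Riemann_sum_indicator_less[OF bE(1) neg \<open>\<epsilon> > 0\<close>] by metis
  obtain d' where "d' > 0"
    and d': "\<And>p. p tagged_division_of cbox a b \<Longrightarrow> (\<lambda>x. ball x d') fine p \<Longrightarrow>
       Riemann_sum (indicator E') p < measure lebesgue E' + \<epsilon>"
    using Riemann_sum_indicator_less[OF bE(2) negE' \<open>\<epsilon> > 0\<close>] by metis
  \<comment> \<open>Riemann sums of the constant 1 are exact, so the upper estimate for
    \<open>E'\<close> turns into a lower estimate for \<open>E\<close>.\<close>
  have compl: "Riemann_sum (indicator E') p = measure lborel (cbox a b) - Riemann_sum (indicator E) p"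
    if "p tagged_division_of cbox a b" for p
  proof -
    have "Riemann_sum (indicator E') p = Riemann_sum (\<lambda>x. 1 - indicator E x) p"
      using that by (rule Riemann_sum_cong) (auto simp: E'_def indicator_def)
    then show ?thesis
      using Riemann_sum_const[OF that, of 1] by (simp add: Riemann_sum_diff)
  qed
  have "\<bar>Riemann_sum (indicator E) p - measure lebesgue E\<bar> < \<epsilon>"
    if p: "p tagged_division_of cbox a b" "(\<lambda>x. ball x (min d d')) fine p" for p
  proof -
    have "Riemann_sum (indicator E) p < measure lebesgue E + \<epsilon>"
      "Riemann_sum (indicator E') p < measure lebesgue E' + \<epsilon>"
      using d[OF p(1) fine_ball_mono[OF p(2) min.cobounded1]]
        d'[OF p(1) fine_ball_mono[OF p(2) min.cobounded2]] by simp_all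
    then show ?thesis
      using compl[OF p(1)] measE' by linarith
  qed
  then show "\<exists>\<delta>>0. \<forall>p. p tagged_division_of cbox a b \<and> (\<lambda>x. ball x \<delta>) fine p \<longrightarrow>
      \<bar>Riemann_sum (indicator E) p - measure lebesgue E\<bar> < \<epsilon>"
    using \<open>d > 0\<close> \<open>d' > 0\<close> by (intro exI[of _ "min d d'"]) auto
qed

section \<open>Riemann integrability of step functions and of bounded K-integrable functions\<close>

lemma has_Riemann_integral_brick:
  assumes "is_brick B" "B \<subseteq> cbox a b"
  shows "has_Riemann_integral (indicator B) (brick_volume B) (cbox a b)"
  using has_Riemann_integral_indicator[OF assms(2)] assms(1)
  by (simp add: is_brick_imp_convex negligible_convex_frontier measure_brick)

lemma has_step_integral_imp_has_Riemann_integral: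
  assumes "has_step_integral g s (cbox a b)"
  shows "has_Riemann_integral g s (cbox a b)"
proof -
  obtain M :: nat and c B where B: "\<forall>j<M. is_brick (B j) \<and> B j \<subseteq> cbox a b"
    and g: "\<forall>x\<in>cbox a b. g x = (\<Sum>j<M. c j * indicator (B j) x)"
    and s: "s = (\<Sum>j<M. c j * brick_volume (B j))"
    using assms unfolding has_step_integral_def by (elim exE conjE)
  have "has_Riemann_integral (\<lambda>x. \<Sum>j<M. c j * indicator (B j) x) s (cbox a b)"
    unfolding s using B
    by (intro has_Riemann_integral_sum has_Riemann_integral_cmult has_Riemann_integral_brick) auto
  then show ?thesis
    by (rule has_Riemann_integral_cong[THEN iffD1, rotated]) (use g in simp)
qed

text \<open>Monotone Riemann sums squeeze \<open>f\<close> between \<open>g - h\<close> and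
  \<open>g + h\<close>. Four errors of \<epsilon>/4 arise: the sums of \<open>g\<close> against
  \<open>t\<close>, \<open>t\<close> against \<open>s\<close>, the sums of \<open>h\<close> against
  \<open>u\<close>, and \<open>u\<close> itself.\<close>

lemma has_Riemann_integral_approx:
  assumes bdd: "bounded (f ` T)"
    and approx: "\<And>e. e > 0 \<Longrightarrow> \<exists>g h t u. has_Riemann_integral g t T \<and> has_Riemann_integral h u T \<and>
      (\<forall>x\<in>T. \<bar>f x - g x\<bar> \<le> h x) \<and> \<bar>t - s\<bar> < e \<and> u < e"
  shows "has_Riemann_integral f s T"
  unfolding has_Riemann_integral_def
proof (intro conjI allI impI)
  fix \<epsilon> :: real assume "\<epsilon> > 0"
  then have \<epsilon>: "\<epsilon> / 4 > 0"
    by simp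
  obtain g h t u where g: "has_Riemann_integral g t T" and h: "has_Riemann_integral h u T"
    and fg: "\<And>x. x \<in> T \<Longrightarrow> \<bar>f x - g x\<bar> \<le> h x" and t: "\<bar>t - s\<bar> < \<epsilon> / 4" and u: "u < \<epsilon> / 4"
    using approx[OF \<epsilon>] by blast
  obtain d where "d > 0"
    and d: "\<And>p. p tagged_division_of T \<Longrightarrow> (\<lambda>x. ball x d) fine p \<Longrightarrow> \<bar>Riemann_sum g p - t\<bar> < \<epsilon> / 4"
    using g \<epsilon> unfolding has_Riemann_integral_def by metis
  obtain e where "e > 0"
    and e: "\<And>p. p tagged_division_of T \<Longrightarrow> (\<lambda>x. ball x e) fine p \<Longrightarrow> \<bar>Riemann_sum h p - u\<bar> < \<epsilon> / 4"
    using h \<epsilon> unfolding has_Riemann_integral_def by metis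
  have "\<bar>Riemann_sum f p - s\<bar> < \<epsilon>"
    if p: "p tagged_division_of T" "(\<lambda>x. ball x (min d e)) fine p" for p
  proof -
    have "Riemann_sum f p \<le> Riemann_sum (\<lambda>x. g x + h x) p"
      using p(1) fg by (intro Riemann_sum_mono) (auto simp: abs_le_iff algebra_simps)
    moreover have "Riemann_sum (\<lambda>x. g x - h x) p \<le> Riemann_sum f p"
    proof (rule Riemann_sum_mono[OF p(1)])
      show "g x - h x \<le> f x" if "x \<in> T" for x
        using fg[OF that] by linarith
    qed
    moreover have "\<bar>Riemann_sum g p - t\<bar> < \<epsilon> / 4"
      using d[OF p(1)] fine_ball_mono[OF p(2)] by simp
    moreover have "\<bar>Riemann_sum h p - u\<bar> < \<epsilon> / 4"
      using e[OF p(1)] fine_ball_mono[OF p(2)] by simp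
    ultimately show ?thesis
      using t u unfolding Riemann_sum_add Riemann_sum_diff by linarith
  qed
  then show "\<exists>\<delta>>0. \<forall>p. p tagged_division_of T \<and> (\<lambda>x. ball x \<delta>) fine p \<longrightarrow>
      \<bar>Riemann_sum f p - s\<bar> < \<epsilon>"
    using \<open>d > 0\<close> \<open>e > 0\<close> by (intro exI[of _ "min d e"]) auto
qed (rule bdd)

lemma K_integrable_imp_has_Riemann_integral:
  assumes K: "f K_integrable_on cbox a b" and bdd: "bounded (f ` cbox a b)"
  shows "has_Riemann_integral f (integral (cbox a b) f) (cbox a b)"
proof (rule has_Riemann_integral_approx[OF bdd])
  fix e :: real assume "e > 0"
  obtain F where F: "\<And>m. step_function_on (cbox a b) (F m)" and lim: "nearly_uniform_limit (cbox a b) F f"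
    using K unfolding K_integrable_on_def by blast
  obtain C where C: "\<And>m x. x \<in> cbox a b \<Longrightarrow> \<bar>F m x\<bar> \<le> C"
    using lim unfolding nearly_uniform_limit_def by blast
  obtain C' where C': "\<And>x. x \<in> cbox a b \<Longrightarrow> \<bar>f x\<bar> \<le> C'"
    using bdd unfolding bounded_iff by auto
  define V where "V = measure lborel (cbox a b)"
  have "V \<ge> 0"
    by (simp add: V_def)
  \<comment> \<open>\<open>D\<close> bounds the difference of \<open>f\<close> and any
    \<open>F m\<close> on the whole box; the summand 1 makes it a legitimate divisor.\<close>
  define D where "D = \<bar>C\<bar> + \<bar>C'\<bar> + 1"
  have "D > 0"
    by (simp add: D_def)
  \<comment> \<open>With this tolerance \<open>V * r\<close> is at most \<open>e / 2\<close>;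
    \<open>V + 1\<close> guards against a box of volume 0.\<close>
  define r where "r = e / (2 * (V + 1))"
  have "r > 0"
    using \<open>e > 0\<close> \<open>V \<ge> 0\<close> by (simp add: r_def)
  have "e / (2 * D) > 0"
    using \<open>e > 0\<close> \<open>D > 0\<close> by simp
  then obtain \<B> where \<B>: "finite \<B>" "\<forall>B\<in>\<B>. is_brick B \<and> B \<subseteq> cbox a b"
    "(\<Sum>B\<in>\<B>. brick_volume B) < e / (2 * D)" "uniform_limit (cbox a b - \<Union>\<B>) F f sequentially"
    using nearly_uniform_limit_cover[OF lim] by metis
  have "\<forall>\<^sub>F m in sequentially. \<forall>x\<in>cbox a b - \<Union>\<B>. dist (F m x) (f x) < r"
    using \<B>(4) \<open>r > 0\<close> by (rule uniform_limitD)
  moreover have "\<forall>\<^sub>F m in sequentially. dist (integral (cbox a b) (F m)) (integral (cbox a b) f) < e"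
    using nearly_uniform_limit_integral[OF lim] F \<open>e > 0\<close> by (intro tendstoD) (auto simp: step_function_integrable)
  \<comment> \<open>A single index must serve both purposes: uniform closeness off the bricks and
    closeness of the integrals.\<close>
  ultimately have "\<exists>m. (\<forall>x\<in>cbox a b - \<Union>\<B>. dist (F m x) (f x) < r) \<and>
      dist (integral (cbox a b) (F m)) (integral (cbox a b) f) < e"
    by (intro eventually_happens'[OF sequentially_bot] eventually_conj)
  then obtain m where "\<forall>x\<in>cbox a b - \<Union>\<B>. dist (F m x) (f x) < r"
      "dist (integral (cbox a b) (F m)) (integral (cbox a b) f) < e"
    by (elim exE conjE)
  then have m: "\<And>x. x \<in> cbox a b - \<Union>\<B> \<Longrightarrow> \<bar>F m x - f x\<bar> < r"
    "\<bar>integral (cbox a b) (F m) - integral (cbox a b) f\<bar> < e"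
    by (simp_all add: dist_real_def)
  \<comment> \<open>The error is below \<open>r\<close> off the bricks and at most \<open>D\<close>
    on them. The sum of indicators is at least 1 on the union, and overlaps only enlarge the
    bound.\<close>
  define h where "h x = r + D * (\<Sum>B\<in>\<B>. indicator B x)" for x
  define u where "u = V * r + D * (\<Sum>B\<in>\<B>. brick_volume B)"
  have "has_Riemann_integral (F m) (integral (cbox a b) (F m)) (cbox a b)"
    using F by (intro has_step_integral_imp_has_Riemann_integral has_step_integral_integral)
  moreover have "has_Riemann_integral h u (cbox a b)"
    unfolding h_def u_def V_def using \<B>(1,2)
    by (intro has_Riemann_integral_add has_Riemann_integral_const has_Riemann_integral_cmult
        has_Riemann_integral_sum has_Riemann_integral_brick) auto
  moreover have "\<bar>f x - F m x\<bar> \<le> h x" if x: "x \<in> cbox a b" for x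
  proof (cases "x \<in> \<Union>\<B>")
    case True
    then obtain B where "B \<in> \<B>" "x \<in> B"
      by blast
    then have "1 \<le> (\<Sum>B\<in>\<B>. indicator B x :: real)"
      using member_le_sum[of B \<B> "\<lambda>B. indicator B x :: real"] \<B>(1) by simp
    then have "D \<le> D * (\<Sum>B\<in>\<B>. indicator B x)"
      using \<open>D > 0\<close> by simp
    then show ?thesis
      using C[OF x, of m] C'[OF x] \<open>r > 0\<close> by (simp add: h_def D_def)
  next
    case False
    have "0 \<le> D * (\<Sum>B\<in>\<B>. indicator B x)"
      using \<open>D > 0\<close> by (intro mult_nonneg_nonneg sum_nonneg) auto
    then show ?thesis
      using m(1)[of x] x False by (simp add: h_def)
  qed
  moreover have "u < e"
  proof -
    have "V * r \<le> e / 2"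
      using \<open>V \<ge> 0\<close> \<open>e > 0\<close> by (simp add: r_def field_simps)
    moreover have "D * (\<Sum>B\<in>\<B>. brick_volume B) < e / 2"
      using \<B>(3) \<open>D > 0\<close> by (simp add: field_simps)
    ultimately show ?thesis
      by (simp add: u_def)
  qed
  ultimately show "\<exists>g h t u. has_Riemann_integral g t (cbox a b) \<and> has_Riemann_integral h u (cbox a b) \<and>
      (\<forall>x\<in>cbox a b. \<bar>f x - g x\<bar> \<le> h x) \<and> \<bar>t - integral (cbox a b) f\<bar> < e \<and> u < e"
    using m(2) by blast
qed

section \<open>A Riemann integrable function that is not K-integrable\<close>

definition rat_enum :: "nat \<Rightarrow> real" where
  "rat_enum = from_nat_into \<rat>"

text \<open>Including the limit 0 makes the set compact; its translate by a rational accumulates at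
  that rational from the right.\<close>

definition null_seq_set :: "real set" where
  "null_seq_set = insert 0 (range (\<lambda>m. inverse (real (Suc m))))"

text \<open>
  For each \<open>\<epsilon> > 0\<close> the set where \<open>comb \<ge> \<epsilon>\<close> lies in a compact countable set, which gives Riemann
  integrability; but there is no right-hand limit at any rational, since nonzero values accumulate
  there without tending to \<open>0\<close> while the zeros are dense.
\<close>

definition comb :: "real \<Rightarrow> real" where
  "comb t = (if \<exists>k. t - rat_enum k \<in> null_seq_set
     then inverse (real (Suc (LEAST k. t - rat_enum k \<in> null_seq_set))) else 0)"

lemma range_rat_enum: "range rat_enum = \<rat>"
  unfolding rat_enum_def by (rule range_from_nat_into) (auto intro: Rats_0 countable_rat)

lemma compact_null_seq_set: "compact null_seq_set"
  unfolding null_seq_set_def by (rule compact_sequence_with_limit) (rule LIMSEQ_inverse_real_of_nat)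

lemma countable_null_seq_set: "countable null_seq_set"
  by (simp add: null_seq_set_def)

lemma comb_nonneg: "0 \<le> comb t"
  by (simp add: comb_def)

lemma comb_le_1: "comb t \<le> 1"
  by (simp add: comb_def inverse_le_1_iff)

text \<open>Outside the translates with index at most \<open>n\<close>, the least admissible index,
  if there is one, exceeds \<open>n\<close>.\<close>

lemma comb_le:
  assumes "t \<notin> (\<Union>k\<le>n. (+) (rat_enum k) ` null_seq_set)"
  shows "comb t \<le> inverse (real (Suc n))"
proof (cases "\<exists>k. t - rat_enum k \<in> null_seq_set")
  case True
  define k where "k = (LEAST k. t - rat_enum k \<in> null_seq_set)"
  have "t - rat_enum k \<in> null_seq_set"
    unfolding k_def using True by (rule LeastI_ex)
  then have "t \<in> (+) (rat_enum k) ` null_seq_set"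
    by (rule rev_image_eqI) simp
  then have "n < k"
    using assms by (auto simp: not_le[symmetric])
  then show ?thesis
    using True by (simp add: comb_def k_def[symmetric] le_imp_inverse_le)
qed (simp add: comb_def)

text \<open>The index \<open>k\<close> is itself admissible at this point, so the least one is at
  most \<open>k\<close>. The bound is uniform in \<open>m\<close>, hence persists as the points
  approach \<open>rat_enum k\<close>.\<close>

lemma comb_ge: "inverse (real (Suc k)) \<le> comb (rat_enum k + inverse (real (Suc m)))"
proof -
  define P where "P l \<longleftrightarrow> rat_enum k + inverse (real (Suc m)) - rat_enum l \<in> null_seq_set" for l
  have "P k"
    by (simp add: P_def null_seq_set_def)
  then have "(LEAST l. P l) \<le> k" "\<exists>l. P l"
    by (auto intro: Least_le)
  then show ?thesis
    unfolding comb_def P_def[symmetric] by (simp add: le_imp_inverse_le)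
qed

text \<open>Since open intervals are uncountable, this puts a zero of \<open>comb\<close> into each
  of them.\<close>

lemma countable_comb_nonzero: "countable {t. comb t \<noteq> 0}"
proof (rule countable_subset)
  show "{t. comb t \<noteq> 0} \<subseteq> (\<Union>k. (+) (rat_enum k) ` null_seq_set)"
  proof
    fix t assume "t \<in> {t. comb t \<noteq> 0}"
    then obtain k where "t - rat_enum k \<in> null_seq_set"
      by (auto simp: comb_def split: if_splits)
    then have "t \<in> (+) (rat_enum k) ` null_seq_set"
      by (rule rev_image_eqI) simp
    then show "t \<in> (\<Union>k. (+) (rat_enum k) ` null_seq_set)"
      by blast
  qed
qed (simp add: countable_null_seq_set)

section \<open>Riemann integrability of the comb\<close>

lemma
  fixes A :: "real set" and i :: "'n::finite"
  shows closed_component_in: "closed A \<Longrightarrow> closed {x :: real ^ 'n. x $ i \<in> A}"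
    and negligible_component_in: "countable A \<Longrightarrow> negligible {x :: real ^ 'n. x $ i \<in> A}"
proof -
  show "closed {x :: real ^ 'n. x $ i \<in> A}" if "closed A"
    using closed_vimage[OF that, of "\<lambda>x :: real ^ 'n. x $ i"]
    by (simp add: vimage_def continuous_intros)
next
  assume A: "countable A"
  have "negligible (\<Union>c\<in>A. {x :: real ^ 'n. x $ i = c})"
  proof (rule negligible_countable_Union)
    show "negligible S" if "S \<in> (\<lambda>c. {x :: real ^ 'n. x $ i = c}) ` A" for S
      using that by (auto simp: cart_eq_inner_axis negligible_standard_hyperplane)
  qed (simp add: A)
  moreover have "(\<Union>c\<in>A. {x :: real ^ 'n. x $ i = c}) = {x. x $ i \<in> A}"
    by blast
  ultimately show "negligible {x :: real ^ 'n. x $ i \<in> A}"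
    by simp
qed

lemma has_Riemann_integral_comb:
  fixes i :: "'n::finite"
  shows "has_Riemann_integral (\<lambda>x. comb (x $ i)) 0 (cbox a b)"
proof (rule has_Riemann_integral_approx)
  show "bounded ((\<lambda>x. comb (x $ i)) ` cbox a b)"
    unfolding bounded_iff using comb_nonneg comb_le_1 by (intro exI[of _ 1]) auto
next
  fix e :: real assume "e > 0"
  define V where "V = measure lborel (cbox a b)"
  have "e / (V + 1) > 0"
    using \<open>e > 0\<close> by (simp add: V_def add_nonneg_pos)
  then obtain n where n: "inverse (real (Suc n)) < e / (V + 1)"
    using reals_Archimedean by blast
  define A where "A = (\<Union>k\<le>n. (+) (rat_enum k) ` null_seq_set)"
  have A: "closed A" "countable A"
    unfolding A_def
    by (auto intro!: compact_imp_closed compact_UN compact_translation compact_null_seq_set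
        simp: countable_null_seq_set)
  \<comment> \<open>Only finitely many compact translates enter \<open>A\<close>, so
    \<open>E\<close> is closed; being also null, it has a null frontier, and its indicator has
    Riemann integral 0. The approximant of the comb is the zero function, with error
    \<open>inverse (real (Suc n))\<close> off \<open>E\<close> and at most 1 on it.\<close>
  define E where "E = cbox a b \<inter> {x. x $ i \<in> A}"
  have "closed E"
    unfolding E_def using A by (intro closed_Int closed_cbox closed_component_in)
  have "negligible E"
    unfolding E_def using negligible_component_in[OF A(2), of i] by (rule negligible_subset) blast
  then have "negligible (frontier E)"
    using frontier_subset_closed[OF \<open>closed E\<close>] by (rule negligible_subset)
  then have "has_Riemann_integral (indicator E) (measure lebesgue E) (cbox a b)"
    by (intro has_Riemann_integral_indicator) (auto simp: E_def)
  then have "has_Riemann_integral (\<lambda>x. inverse (real (Suc n)) + indicator E x)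
      (V * inverse (real (Suc n)) + 0) (cbox a b)"
    unfolding V_def using \<open>negligible E\<close>
    by (intro has_Riemann_integral_add has_Riemann_integral_const) (simp add: negligible_imp_measure0)
  moreover have "has_Riemann_integral (\<lambda>x. 0) 0 (cbox a b)"
    using has_Riemann_integral_const[of 0] by simp
  moreover have "\<forall>x\<in>cbox a b. \<bar>comb (x $ i) - 0\<bar> \<le> inverse (real (Suc n)) + indicator E x"
  proof
    fix x assume x: "x \<in> cbox a b"
    show "\<bar>comb (x $ i) - 0\<bar> \<le> inverse (real (Suc n)) + indicator E x"
    proof (cases "x $ i \<in> A")
      case True
      then show ?thesis
        using x comb_nonneg[of "x $ i"] comb_le_1[of "x $ i"] by (simp add: E_def add_increasing)
    next
      case False
      then show ?thesis
        using comb_nonneg[of "x $ i"] comb_le[of "x $ i" n] by (simp add: E_def A_def)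
    qed
  qed
  moreover have "V * inverse (real (Suc n)) + 0 < e"
  proof -
    have "V * inverse (real (Suc n)) \<le> (V + 1) * inverse (real (Suc n))"
      by (intro mult_right_mono) auto
    also have "\<dots> < e"
      using n by (simp add: V_def pos_less_divide_eq add_nonneg_pos mult.commute)
    finally show ?thesis
      by simp
  qed
  moreover have "\<bar>0 - 0 :: real\<bar> < e"
    using \<open>e > 0\<close> by simp
  ultimately show "\<exists>g h t u. has_Riemann_integral g t (cbox a b) \<and> has_Riemann_integral h u (cbox a b) \<and>
      (\<forall>x\<in>cbox a b. \<bar>comb (x $ i) - g x\<bar> \<le> h x) \<and> \<bar>t - 0\<bar> < e \<and> u < e"
    by (intro exI conjI)
qed

section \<open>Step functions along rays and the failure of K-integrability\<close>

lemma convex_indicator_eventually_const: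
  fixes B :: "'a::real_vector set"
  assumes "convex B"
  shows "\<exists>c. \<forall>\<^sub>F t in at_right (0::real). indicat_real B (z + t *\<^sub>R e) = c"
\<comment> \<open>Either an initial piece of the ray, without its origin, misses \<open>B\<close>,
  or \<open>B\<close> contains points of the ray arbitrarily close to the origin. In the second case
  convexity fills the ray from the origin up to any later point of \<open>B\<close>.\<close>
proof (cases "\<exists>b>0. \<forall>t. 0 < t \<and> t < b \<longrightarrow> z + t *\<^sub>R e \<notin> B")
  case True
  then have "\<forall>\<^sub>F t in at_right (0::real). indicat_real B (z + t *\<^sub>R e) = 0"
    unfolding eventually_at_right_field by auto
  then show ?thesis ..
next
  case False
  then obtain s where s: "0 < s" "z + s *\<^sub>R e \<in> B"
    using zero_less_one by blast
  have "z + t *\<^sub>R e \<in> B" if t: "0 < t" "t < s" for t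
  proof -
    obtain r where r: "0 < r" "r < t" "z + r *\<^sub>R e \<in> B"
      using False t(1) by blast
    \<comment> \<open>The weight that writes \<open>t\<close> as a convex combination of
      \<open>r\<close> and \<open>s\<close>.\<close>
    define u where "u = (t - r) / (s - r)"
    have "u * (s - r) = t - r"
      using r t by (simp add: u_def)
    then have u: "(1 - u) * r + u * s = t"
      by (simp add: algebra_simps)
    have "0 \<le> u" "u \<le> 1"
      using r t by (simp_all add: u_def)
    then have "(1 - u) *\<^sub>R (z + r *\<^sub>R e) + u *\<^sub>R (z + s *\<^sub>R e) \<in> B"
      using convexD_alt[OF assms r(3) s(2)] by blast
    moreover have "(1 - u) *\<^sub>R (z + r *\<^sub>R e) + u *\<^sub>R (z + s *\<^sub>R e) = z + ((1 - u) * r + u * s) *\<^sub>R e"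
      by (simp add: algebra_simps)
    ultimately show ?thesis
      by (simp add: u)
  qed
  then have "\<forall>\<^sub>F t in at_right (0::real). indicat_real B (z + t *\<^sub>R e) = 1"
    unfolding eventually_at_right_field using s(1) by auto
  then show ?thesis ..
qed

text \<open>Finitely many eventually constant indicators are constant simultaneously near the origin
  of the ray. The representation of \<open>g\<close> holds on \<open>T\<close> only, so the ray has
  to start out inside \<open>T\<close>.\<close>

lemma step_function_eventually_const:
  assumes "step_function_on T g" and T: "\<forall>\<^sub>F t in at_right 0. z + t *\<^sub>R e \<in> T"
  shows "\<exists>c. \<forall>\<^sub>F t in at_right 0. g (z + t *\<^sub>R e) = c"
proof -
  obtain M :: nat and c B where B: "\<forall>j<M. is_brick (B j) \<and> B j \<subseteq> T"
    and g: "\<forall>x\<in>T. g x = (\<Sum>j<M. c j * indicator (B j) x)"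
    using assms(1) unfolding step_function_on_def by (elim exE conjE)
  have "\<forall>j<M. \<exists>d. \<forall>\<^sub>F t in at_right 0. indicat_real (B j) (z + t *\<^sub>R e) = d"
    using B by (simp add: convex_indicator_eventually_const is_brick_imp_convex)
  then obtain d where "\<forall>j<M. \<forall>\<^sub>F t in at_right 0. indicat_real (B j) (z + t *\<^sub>R e) = d j"
    by metis
  then have "\<forall>\<^sub>F t in at_right 0. \<forall>j\<in>{..<M}. indicat_real (B j) (z + t *\<^sub>R e) = d j"
    by (intro eventually_ball_finite) auto
  with T have "\<forall>\<^sub>F t in at_right 0. g (z + t *\<^sub>R e) = (\<Sum>j<M. c j * d j)"
  proof eventually_elim
    case (elim t)
    have "g (z + t *\<^sub>R e) = (\<Sum>j<M. c j * indicator (B j) (z + t *\<^sub>R e))"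
      using g elim(1) by blast
    also have "\<dots> = (\<Sum>j<M. c j * d j)"
      using elim(2) by (intro sum.cong) auto
    finally show ?case .
  qed
  then show ?thesis ..
qed

text \<open>Some ball avoids the exceptional bricks. From a point of it whose coordinate
  \<open>i\<close> is rational, a step function is constant for a while in the direction of that
  axis, whereas the comb keeps oscillating by a fixed amount.\<close>

lemma not_K_integrable_comb:
  fixes i :: "'n::finite"
  shows "\<not> (\<lambda>x :: real ^ 'n. comb (x $ i)) K_integrable_on cbox 0 1"
proof
  let ?T = "cbox 0 1 :: (real ^ 'n) set" and ?f = "\<lambda>x :: real ^ 'n. comb (x $ i)"
  let ?e = "axis i 1 :: real ^ 'n"
  assume "?f K_integrable_on ?T"
  then obtain F where F: "\<forall>m. step_function_on ?T (F m)" and lim: "nearly_uniform_limit ?T F ?f"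
    unfolding K_integrable_on_def by (elim exE conjE)
  obtain \<B> where \<B>: "finite \<B>" "\<forall>B\<in>\<B>. is_brick B \<and> B \<subseteq> ?T"
    "(\<Sum>B\<in>\<B>. brick_volume B) < 1" "uniform_limit (?T - \<Union>\<B>) F ?f sequentially"
    using nearly_uniform_limit_cover[OF lim zero_less_one] .
  \<comment> \<open>Removing closures makes \<open>G\<close> open, so that rays starting in it
    remain in it for a while.\<close>
  define G where "G = box 0 1 - (\<Union>B\<in>\<B>. closure B)"
  have "open G"
    unfolding G_def using \<B>(1) by (intro open_Diff open_box closed_UN) auto
  have GT: "x \<in> ?T - \<Union>\<B>" if "x \<in> G" for x
    using that box_subset_cbox[of 0 "1 :: real ^ 'n"] closure_subset unfolding G_def by blast
  have "G \<noteq> {}"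
  \<comment> \<open>Taking closures does not change the measure of a brick, so bricks of total
    volume below 1 cannot cover the open unit cube.\<close>
  proof
    assume "G = {}"
    then have sub: "box 0 1 \<subseteq> (\<Union>B\<in>\<B>. closure B)"
      by (simp add: G_def)
    have cl: "closure B \<in> lmeasurable" "measure lebesgue (closure B) = brick_volume B" if "B \<in> \<B>" for B
      using \<B>(2) that lmeasurable_closure is_brick_imp_bounded measure_closure
        negligible_convex_frontier is_brick_imp_convex measure_brick by metis+
    have "(\<Union>B\<in>\<B>. closure B) \<in> lmeasurable"
      using \<B>(1) cl by (intro fmeasurable.finite_UN) auto
    then have "measure lebesgue (box 0 1 :: (real ^ 'n) set) \<le> measure lebesgue (\<Union>B\<in>\<B>. closure B)"
      using sub by (intro measure_mono_fmeasurable) auto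
    also have "\<dots> \<le> (\<Sum>B\<in>\<B>. measure lebesgue (closure B))"
      using \<B>(1) cl by (intro measure_UNION_le) (auto simp: fmeasurableD)
    also have "\<dots> = (\<Sum>B\<in>\<B>. brick_volume B)"
      using cl by (intro sum.cong) auto
    also have "\<dots> < 1"
      by (rule \<B>(3))
    finally have "measure lborel ?T < 1"
      by (simp add: measure_lborel_box_eq measure_lborel_cbox_eq)
    moreover have "measure lborel ?T = 1"
    proof -
      have "0 \<in> ?T"
        by (simp add: mem_box_cart)
      then have "?T \<noteq> {}"
        by blast
      then show ?thesis
        by (simp add: content_cbox_cart)
    qed
    ultimately show False
      by simp
  qed
  then obtain y r where "r > 0" and y: "ball y r \<subseteq> G"
    using \<open>open G\<close> open_contains_ball by blast
  obtain k where k: "y $ i < rat_enum k" "rat_enum k < y $ i + r"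
    using Rats_dense_in_real[of "y $ i" "y $ i + r"] \<open>r > 0\<close> range_rat_enum
    by (metis imageE less_add_same_cancel1)
  \<comment> \<open>\<open>y\<close> is shifted along the axis until its coordinate \<open>i\<close>
    becomes the rational \<open>rat_enum k\<close>; the shift is shorter than
    \<open>r\<close>.\<close>
  define z where "z = y + (rat_enum k - y $ i) *\<^sub>R ?e"
  have zi: "(z + t *\<^sub>R ?e) $ i = rat_enum k + t" for t
    by (simp add: z_def)
  have "dist y z < r"
    using k by (simp add: z_def dist_norm)
  then have "z \<in> G"
    using y by auto
  have "((\<lambda>t. z + t *\<^sub>R ?e) \<longlongrightarrow> z + 0 *\<^sub>R ?e) (at_right 0)"
    by (intro tendsto_intros)
  then have ev_G: "\<forall>\<^sub>F t in at_right 0. z + t *\<^sub>R ?e \<in> G"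
    using \<open>open G\<close> \<open>z \<in> G\<close> by (intro topological_tendstoD) auto
  \<comment> \<open>Half of the lower bound from \<open>comb_ge\<close>: the constant
    \<open>c\<close> cannot be within \<epsilon> both of 0 and of a value that is at least
    2\<epsilon>.\<close>
  define \<epsilon> where "\<epsilon> = inverse (real (Suc k)) / 2"
  have "\<epsilon> > 0"
    by (simp add: \<epsilon>_def)
  then have "\<exists>m. \<forall>x\<in>?T - \<Union>\<B>. dist (F m x) (?f x) < \<epsilon>"
    using \<B>(4) by (intro eventually_happens'[OF sequentially_bot] uniform_limitD)
  then obtain m where m: "\<forall>x\<in>?T - \<Union>\<B>. dist (F m x) (?f x) < \<epsilon>" ..
  have "\<forall>\<^sub>F t in at_right 0. z + t *\<^sub>R ?e \<in> ?T"
    using ev_G by eventually_elim (use GT in blast)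
  then obtain c where "\<forall>\<^sub>F t in at_right 0. F m (z + t *\<^sub>R ?e) = c"
    using step_function_eventually_const F by blast
  with ev_G have "\<forall>\<^sub>F t in at_right 0. \<bar>c - comb (rat_enum k + t)\<bar> < \<epsilon>"
  proof eventually_elim
    case (elim t)
    then have "dist (F m (z + t *\<^sub>R ?e)) (?f (z + t *\<^sub>R ?e)) < \<epsilon>"
      using m GT by blast
    then show ?case
      unfolding zi elim(2) dist_real_def .
  qed
  then obtain b where "b > 0" and b: "\<forall>t>0. t < b \<longrightarrow> \<bar>c - comb (rat_enum k + t)\<bar> < \<epsilon>"
    unfolding eventually_at_right_field by blast
  obtain l where "inverse (real (Suc l)) < b"
    using reals_Archimedean[OF \<open>b > 0\<close>] by blast
  then have "\<bar>c - comb (rat_enum k + inverse (real (Suc l)))\<bar> < \<epsilon>"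
    using b by simp
  moreover have "inverse (real (Suc k)) \<le> comb (rat_enum k + inverse (real (Suc l)))"
    by (rule comb_ge)
  \<comment> \<open>Arbitrarily close to the rational on its right the comb also vanishes, because
    the interval is uncountable.\<close>
  moreover obtain s where s: "s \<in> {rat_enum k<..<rat_enum k + b}" "comb s = 0"
  proof -
    have "\<not> {rat_enum k<..<rat_enum k + b} \<subseteq> {t. comb t \<noteq> 0}"
      using countable_subset[OF _ countable_comb_nonzero] uncountable_open_interval \<open>b > 0\<close>
      by (metis less_add_same_cancel1)
    then show ?thesis
      using that by blast
  qed
  have "\<bar>c - comb (rat_enum k + (s - rat_enum k))\<bar> < \<epsilon>"
    using b[rule_format, of "s - rat_enum k"] s(1) by simp
  ultimately show False
    using s(2) by (simp add: \<epsilon>_def)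
qed

section \<open>Transfer of the three claims to closed bricks\<close>

lemma is_brick_cbox:
  fixes a b :: "real ^ 'n::finite"
  assumes "\<And>i. a $ i \<le> b $ i"
  shows "is_brick (cbox a b)"
  unfolding is_brick_def
proof (intro exI conjI allI)
  show "cbox a b = box_prod (\<lambda>i. {a $ i..b $ i})"
    by (auto simp: box_prod_def mem_box_cart)
  show "is_interval {a $ i..b $ i}" "bounded {a $ i..b $ i}" "{a $ i..b $ i} \<noteq> {}" for i
    using assms by (auto simp: is_interval_cc)
qed

theorem proposition4p1:
  "(\<forall>(T :: (real ^ 'n::finite) set) f.
      is_brick T \<and> closed T \<and> f K_integrable_on T \<and> \<not> bounded (f ` T) \<longrightarrow>
      (\<exists>g. g K_integrable_on T \<and> bounded (g ` T) \<and>
           Jordan_ae_on T (\<lambda>x. g x = f x) \<and>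
           K_integral T f = K_integral T g)) \<and>
   (\<forall>(T :: (real ^ 'n::finite) set) f.
      is_brick T \<and> closed T \<and> f K_integrable_on T \<and> bounded (f ` T) \<longrightarrow>
      f Riemann_integrable_on T \<and> K_integral T f = Riemann_integral T f) \<and>
   (\<exists>(T :: (real ^ 'n::finite) set) f.
      is_brick T \<and> closed T \<and> f Riemann_integrable_on T \<and> \<not> f K_integrable_on T)"
proof (intro conjI allI impI; (elim conjE)?)
  fix T :: "(real ^ 'n) set" and f
  assume "is_brick T" "closed T" and K: "f K_integrable_on T"
  obtain a b where T: "T = cbox a b"
    using \<open>is_brick T\<close> \<open>closed T\<close> by (rule closed_brick_eq_cbox)
  show "\<exists>g. g K_integrable_on T \<and> bounded (g ` T) \<and> Jordan_ae_on T (\<lambda>x. g x = f x) \<and>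
      K_integral T f = K_integral T g"
    using K_integrable_bounded_modification[OF K[unfolded T]] unfolding T by metis
next
  fix T :: "(real ^ 'n) set" and f
  assume "is_brick T" "closed T" and K: "f K_integrable_on T" and bdd: "bounded (f ` T)"
  obtain a b where T: "T = cbox a b"
    using \<open>is_brick T\<close> \<open>closed T\<close> by (rule closed_brick_eq_cbox)
  have R: "has_Riemann_integral f (integral T f) T"
    using K_integrable_imp_has_Riemann_integral K bdd unfolding T by blast
  then show "f Riemann_integrable_on T"
    unfolding Riemann_integrable_on_def by blast
  show "K_integral T f = Riemann_integral T f"
    using K R unfolding T by (simp add: K_integral_eq_integral Riemann_integral_eq)
next
  have "is_brick (cbox 0 1 :: (real ^ 'n) set)"
    by (rule is_brick_cbox) simp
  \<comment> \<open>Every coordinate serves equally well; \<open>undefined\<close> names an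
    arbitrary one.\<close>
  moreover have "(\<lambda>x :: real ^ 'n. comb (x $ undefined)) Riemann_integrable_on cbox 0 1"
    unfolding Riemann_integrable_on_def using has_Riemann_integral_comb by blast
  ultimately show "\<exists>(T :: (real ^ 'n) set) f.
      is_brick T \<and> closed T \<and> f Riemann_integrable_on T \<and> \<not> f K_integrable_on T"
    using not_K_integrable_comb closed_cbox by blast
qed

end
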